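(* Let $\mathcal I$ be the abstract quantum cluster structure over the empty graph, i.e. $\mathcal I=(\mathcal E(\varnothing),\mathcal X,\beta,\lambda,\mathcal A,\langle-,-\rangle)$ where $\mathcal E(\varnothing)$ is the empty category, $\mathcal X\colon\mathcal E(\varnothing)^{op}\to\mathrm{Ab}$ and $\mathcal A\colon\mathcal E(\varnothing)\to\mathrm{Ab}$ are the unique (empty) functors, and $\beta,\lambda,\langle-,-\rangle$ are the empty families. Then $\mathcal I$ is initial in the category $\mathbf{AQCS}$ of abstract quantum cluster structures.
   Context: Ab is the category of abelian groups; $A^*=\mathrm{Hom}_{\mathbb Z}(A,\mathbb Z)$; for $F\colon\mathcal C\to \mathrm{Ab}$, $F^*\colon\mathcal C^{op}\to\mathrm{Ab}$ is $F^*c=(Fc)^*$, $F^*f=(Ff)^*$. Signed path category. Let $E$ be a simple directed graph (no loops, at most one arrow with given source and target; 2-cycles allowed). $E_\pm$ has the same vertices and, for each arrow $\alpha\colon c\to d$ of $E$, two arrows $\alpha^+,\alpha^-\colon c\to d$. $\mathcal E(E)$ is the quotient of the path category of $E_\pm$ by the relations $\gamma^-\circ\alpha^+=\mathrm{id}_c$ and $\gamma^+\circ\alpha^-=\mathrm{id}_c$ whenever $\alpha\colon c\to d$ and $\gamma\colon d\to c$ are arrows of $E$. Pairing. For $F\colon\mathcal C\to\mathrm{Ab}$ and $G\colon\mathcal C^{op}\to\mathrm{Ab}$, a pairing $\langle-,-\rangle\colon F\otimes_{\mathbb Z}G\to\underline{\mathbb Z}$ is a dinatural transformation, i.e. a family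 of bilinear forms $\langle-,-\rangle_c\colon Fc\times Gc\to\mathbb Z$ with $\langle a,Gf(b)\rangle_c=\langle Ff(a),b\rangle_d$ for all $f\colon c\to d$, $a\in Fc$, $b\in Gd$. It is right non-degenerate if each $\delta_{Gc}\colon Gc\to (Fc)^*$, $b\mapsto\langle-,b\rangle_c$, is injective. A free abelian sheaf is a functor to Ab of the form $\mathrm{Free}_{\mathbb Z}\circ\mathcal B$ with $\mathcal B$ a Set-valued functor on the same domain. Factorization. For $\mathcal P\colon\mathcal E^{op}\to\mathrm{Ab}$ and $\mathcal Q\colon\mathcal E\to\mathrm{Ab}$, a factorization $\mathcal P\to\mathcal Q$ is a family $\theta_c\colon\mathcal Pc\to\mathcal Qc$ with $\theta_d=\mathcal Qf\circ\theta_c\circ\mathcal Pf$ for all $f\colon c\to d$ in $\mathcal E$; a factorization $\mathcal Q\to\mathcal P$ is a family $\theta_c\colon\mathcal Qc\to\mathcal Pc$ with $\theta_c=\mathcal Pf\circ\theta_d\circ\mathcal Qf$. Abstract cluster structure over $E$: a tuple $(\mathcal E,\mathcal X,\beta,\mathcal A,\langle-,-\rangle)$ with $\mathcal E=\mathcal E(E)$, $\mathcal X\colon\mathcal E^{op}\to\mathrm{Ab}$ and $\mathcal A\colon\mathcal E\to\mathrm{Ab}$ free abelian sheaves, $\beta\colon\mathcal X\to\mathcal A$ a factorization, $\langle-,-\rangle\colon\mathcal A\otimes_{\mathbb Z}\mathcal X\to\underline{\mathbb Z}$ a right non-degenerate pairing. Abstract quantum cluster structure: a tuple $(\mathcal E,\mathcal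 X,\beta,\lambda,\mathcal A,\langle-,-\rangle)$ where $(\mathcal E,\mathcal X,\beta,\mathcal A,\langle-,-\rangle)$ is an abstract cluster structure and $\lambda\colon\mathcal A\to\mathcal A^*$ is a factorization of the form $\lambda=\delta_{\mathcal X}\circ\rho$, with $\rho\colon\mathcal A\to\mathcal X$ a factorization such that $\rho_c\circ\beta_c=\mathrm{id}_{\mathcal Xc}$ for all $c$, and $\delta_{\mathcal X}\colon\mathcal X\to\mathcal A^*$ given by $\delta_{\mathcal Xc}(x)=\langle-,x\rangle_c$. A morphism in $\mathbf{AQCS}$ from $(\mathcal E_1,\mathcal X_1,\beta_1,\lambda_1,\mathcal A_1,\langle-,-\rangle^1)$ to $(\mathcal E_2,\mathcal X_2,\beta_2,\lambda_2,\mathcal A_2,\langle-,-\rangle^2)$ is a tuple $(F,\chi,\alpha)$ with $F\colon\mathcal E_1\to\mathcal E_2$ a functor, $\chi\colon\mathcal X_1\to\mathcal X_2F^{op}$ and $\alpha\colon\mathcal A_1\to\mathcal A_2F$ natural transformations, such that for all $c$: $\alpha_c\circ(\beta_1)_c=(\beta_2)_{Fc}\circ\chi_c$ and $(\lambda_1)_c=(\alpha_c)^*\circ(\lambda_2)_{Fc}\circ\alpha_c$. Composition is componentwise, with $(\chi'\circ\chi)_c=\chi'_{Fc}\circ\chi_c$ and $(\alpha'\circ\alpha)_c=\alpha'_{Fc}\circ\alpha_c$. *)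

theory Defs
  imports
    "Graph_Theory.Pair_Digraph"
    "HOL-Algebra.Free_Abelian_Groups"
begin

section \<open>Categories, functors, natural transformations\<close>

record ('o, 'm) cat =
  Obj :: "'o set"
  Arr :: "'m set"
  Dom :: "'m \<Rightarrow> 'o"
  Cod :: "'m \<Rightarrow> 'o"
  Id :: "'o \<Rightarrow> 'm"
  Comp :: "'m \<Rightarrow> 'm \<Rightarrow> 'm"

text \<open>\<open>Comp C g f\<close> is the composite \<open>g\<close> after \<open>f\<close>.\<close>

definition Hom :: "('o, 'm) cat \<Rightarrow> 'o \<Rightarrow> 'o \<Rightarrow> 'm set" where
  "Hom C a b = {f \<in> Arr C. Dom C f = a \<and> Cod C f = b}"

locale category =
  fixes C :: "('o, 'm) cat"
  assumes dom_in: "f \<in> Arr C \<Longrightarrow> Dom C f \<in> Obj C"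
    and cod_in: "f \<in> Arr C \<Longrightarrow> Cod C f \<in> Obj C"
    and id_hom: "a \<in> Obj C \<Longrightarrow> Id C a \<in> Hom C a a"
    and comp_hom: "\<lbrakk>f \<in> Arr C; g \<in> Arr C; Dom C g = Cod C f\<rbrakk>
      \<Longrightarrow> Comp C g f \<in> Hom C (Dom C f) (Cod C g)"
    and id_left: "f \<in> Arr C \<Longrightarrow> Comp C (Id C (Cod C f)) f = f"
    and id_right: "f \<in> Arr C \<Longrightarrow> Comp C f (Id C (Dom C f)) = f"
    and comp_assoc: "\<lbrakk>f \<in> Arr C; g \<in> Arr C; h \<in> Arr C; Dom C g = Cod C f; Dom C h = Cod C g\<rbrakk>
      \<Longrightarrow> Comp C h (Comp C g f) = Comp C (Comp C h g) f"

definition initial :: "('o, 'm) cat \<Rightarrow> 'o \<Rightarrow> bool" where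
  "initial C i \<longleftrightarrow> i \<in> Obj C \<and> (\<forall>x \<in> Obj C. \<exists>!f. f \<in> Hom C i x)"

definition opposite :: "('o, 'm) cat \<Rightarrow> ('o, 'm) cat" where
  "opposite C = \<lparr>Obj = Obj C, Arr = Arr C, Dom = Cod C, Cod = Dom C, Id = Id C,
     Comp = (\<lambda>g f. Comp C f g)\<rparr>"

record ('o1, 'm1, 'o2, 'm2) func =
  ob :: "'o1 \<Rightarrow> 'o2"
  ar :: "'m1 \<Rightarrow> 'm2"

text \<open>All maps are required to be \<^const>\<open>extensional\<close> on their domains of definition, so that
  HOL equality of functors, of families and of homomorphisms is mathematical equality.\<close>

definition is_functor ::
  "('o1, 'm1) cat \<Rightarrow> ('o2, 'm2) cat \<Rightarrow> ('o1, 'm1, 'o2, 'm2) func \<Rightarrow> bool" where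
  "is_functor C D F \<longleftrightarrow>
     ob F \<in> extensional (Obj C) \<and> ar F \<in> extensional (Arr C) \<and>
     (\<forall>c \<in> Obj C. ob F c \<in> Obj D) \<and>
     (\<forall>f \<in> Arr C. ar F f \<in> Hom D (ob F (Dom C f)) (ob F (Cod C f))) \<and>
     (\<forall>c \<in> Obj C. ar F (Id C c) = Id D (ob F c)) \<and>
     (\<forall>f \<in> Arr C. \<forall>g \<in> Arr C. Dom C g = Cod C f \<longrightarrow>
        ar F (Comp C g f) = Comp D (ar F g) (ar F f))"

definition id_func :: "('o, 'm) cat \<Rightarrow> ('o, 'm, 'o, 'm) func" where
  "id_func C = \<lparr>ob = (\<lambda>c \<in> Obj C. c), ar = (\<lambda>f \<in> Arr C. f)\<rparr>"

definition comp_func :: "('o1, 'm1) cat \<Rightarrow> ('o2, 'm2, 'o3, 'm3) func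
    \<Rightarrow> ('o1, 'm1, 'o2, 'm2) func \<Rightarrow> ('o1, 'm1, 'o3, 'm3) func" where
  "comp_func C G F = \<lparr>ob = compose (Obj C) (ob G) (ob F), ar = compose (Arr C) (ar G) (ar F)\<rparr>"

definition nat_trans :: "('o1, 'm1) cat \<Rightarrow> ('o2, 'm2) cat \<Rightarrow> ('o1, 'm1, 'o2, 'm2) func
    \<Rightarrow> ('o1, 'm1, 'o2, 'm2) func \<Rightarrow> ('o1 \<Rightarrow> 'm2) \<Rightarrow> bool" where
  "nat_trans C D F G \<eta> \<longleftrightarrow>
     \<eta> \<in> extensional (Obj C) \<and>
     (\<forall>c \<in> Obj C. \<eta> c \<in> Hom D (ob F c) (ob G c)) \<and>
     (\<forall>f \<in> Arr C. Comp D (ar G f) (\<eta> (Dom C f)) = Comp D (\<eta> (Cod C f)) (ar F f))"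


section \<open>Path categories and quotients\<close>

text \<open>An arrow \<open>(u, p, v)\<close> of the path category is a walk \<open>p\<close> from \<open>u\<close> to \<open>v\<close>, listed in the order
  in which the arcs are traversed.\<close>

definition path_cat :: "('v, 'e) pre_digraph \<Rightarrow> ('v, 'v \<times> 'e list \<times> 'v) cat" where
  "path_cat G = \<lparr>Obj = verts G, Arr = {(u, p, v). pre_digraph.awalk G u p v},
     Dom = (\<lambda>(u, p, v). u), Cod = (\<lambda>(u, p, v). v), Id = (\<lambda>u. (u, [], u)),
     Comp = (\<lambda>(v', q, w) (u, p, v). (u, p @ q, w))\<rparr>"

inductive congr :: "('o, 'm) cat \<Rightarrow> ('m \<times> 'm) set \<Rightarrow> 'm \<Rightarrow> 'm \<Rightarrow> bool"
  for C :: "('o, 'm) cat" and R :: "('m \<times> 'm) set" where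
  base: "(f, g) \<in> R \<Longrightarrow> congr C R f g"
| refl: "f \<in> Arr C \<Longrightarrow> congr C R f f"
| sym: "congr C R f g \<Longrightarrow> congr C R g f"
| trans: "congr C R f g \<Longrightarrow> congr C R g h \<Longrightarrow> congr C R f h"
| comp: "congr C R f f' \<Longrightarrow> congr C R g g' \<Longrightarrow> Dom C g = Cod C f
    \<Longrightarrow> congr C R (Comp C g f) (Comp C g' f')"

definition congr_rel :: "('o, 'm) cat \<Rightarrow> ('m \<times> 'm) set \<Rightarrow> ('m \<times> 'm) set" where
  "congr_rel C R = {(f, g). congr C R f g}"

text \<open>Quotient by the smallest congruence containing \<open>R\<close>, a set of pairs of parallel arrows.
  All members of a class share domain and codomain, and the union of the classes of the composites
  of representatives is a single class.\<close>

definition quotient_cat :: "('o, 'm) cat \<Rightarrow> ('m \<times> 'm) set \<Rightarrow> ('o, 'm set) cat" where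
  "quotient_cat C R = \<lparr>Obj = Obj C, Arr = Arr C // congr_rel C R,
     Dom = (\<lambda>K. the_elem (Dom C ` K)), Cod = (\<lambda>K. the_elem (Cod C ` K)),
     Id = (\<lambda>c. congr_rel C R `` {Id C c}),
     Comp = (\<lambda>L K. \<Union>g \<in> L. \<Union>f \<in> K. congr_rel C R `` {Comp C g f})\<rparr>"


section \<open>Signed path category\<close>

datatype sign = Pos | Neg

text \<open>Simple directed graphs are \<^locale>\<open>pair_loopfree_digraph\<close>s: arcs are ordered pairs of distinct
  vertices; there is no finiteness assumption.\<close>

definition signed_digraph :: "'v pair_pre_digraph \<Rightarrow> ('v, ('v \<times> 'v) \<times> sign) pre_digraph" where
  "signed_digraph E = \<lparr>verts = pverts E, arcs = parcs E \<times> UNIV,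
     tail = (\<lambda>e. fst (fst e)), head = (\<lambda>e. snd (fst e))\<rparr>"

type_synonym 'v spath = "'v \<times> (('v \<times> 'v) \<times> sign) list \<times> 'v"

definition signed_rel :: "'v pair_pre_digraph \<Rightarrow> ('v spath \<times> 'v spath) set" where
  "signed_rel E =
     {((c, [((c, d), Pos), ((d, c), Neg)], c), (c, [], c)) | c d. (c, d) \<in> parcs E \<and> (d, c) \<in> parcs E} \<union>
     {((c, [((c, d), Neg), ((d, c), Pos)], c), (c, [], c)) | c d. (c, d) \<in> parcs E \<and> (d, c) \<in> parcs E}"

definition signed_path_cat :: "'v pair_pre_digraph \<Rightarrow> ('v, 'v spath set) cat" where
  "signed_path_cat E = quotient_cat (path_cat (signed_digraph E)) (signed_rel E)"


section \<open>Sets, abelian groups, duals\<close>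

definition Set_cat :: "('s set, 's set \<times> ('s \<Rightarrow> 's) \<times> 's set) cat" where
  "Set_cat = \<lparr>Obj = UNIV, Arr = {(S, f, T). f \<in> S \<rightarrow>\<^sub>E T},
     Dom = (\<lambda>(S, f, T). S), Cod = (\<lambda>(S, f, T). T), Id = (\<lambda>S. (S, \<lambda>x \<in> S. x, S)),
     Comp = (\<lambda>(T', g, U) (S, f, T). (S, compose S g f, U))\<rparr>"

text \<open>Homomorphisms between groups whose elements live in possibly different types.\<close>

type_synonym ('g, 'h) ab_arr = "'g monoid \<times> ('g \<Rightarrow> 'h) \<times> 'h monoid"

definition ab_hom :: "'g monoid \<Rightarrow> 'h monoid \<Rightarrow> ('g, 'h) ab_arr set" where
  "ab_hom G H = {(G, f, H) | f. comm_group G \<and> comm_group H \<and> f \<in> hom G H \<and> f \<in> extensional (carrier G)}"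

definition ab_id :: "'g monoid \<Rightarrow> ('g, 'g) ab_arr" where
  "ab_id G = (G, \<lambda>x \<in> carrier G. x, G)"

fun ab_comp :: "('h, 'k) ab_arr \<Rightarrow> ('g, 'h) ab_arr \<Rightarrow> ('g, 'k) ab_arr" where
  "ab_comp (H', g, K) (G, f, H) = (G, compose (carrier G) g f, K)"

definition Ab_cat :: "('g monoid, ('g, 'g) ab_arr) cat" where
  "Ab_cat = \<lparr>Obj = {G. comm_group G}, Arr = {(G, f, H). (G, f, H) \<in> ab_hom G H},
     Dom = (\<lambda>(G, f, H). G), Cod = (\<lambda>(G, f, H). H), Id = ab_id, Comp = ab_comp\<rparr>"

definition dual_group :: "'g monoid \<Rightarrow> ('g \<Rightarrow> int) monoid" where
  "dual_group G = \<lparr>carrier = {\<phi> \<in> hom G integer_group. \<phi> \<in> extensional (carrier G)},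
     mult = (\<lambda>\<phi> \<psi>. \<lambda>x \<in> carrier G. \<phi> x + \<psi> x), one = (\<lambda>x \<in> carrier G. 0)\<rparr>"

fun dual_arr :: "('g, 'h) ab_arr \<Rightarrow> ('h \<Rightarrow> int, 'g \<Rightarrow> int) ab_arr" where
  "dual_arr (G, f, H) =
     (dual_group H, \<lambda>\<phi> \<in> carrier (dual_group H). compose (carrier G) \<phi> f, dual_group G)"

definition dual_func :: "('o, 'm) cat \<Rightarrow> ('o, 'm, 'g monoid, ('g, 'g) ab_arr) func
    \<Rightarrow> ('o, 'm, ('g \<Rightarrow> int) monoid, ('g \<Rightarrow> int, 'g \<Rightarrow> int) ab_arr) func" where
  "dual_func C F = \<lparr>ob = (\<lambda>c \<in> Obj C. dual_group (ob F c)), ar = (\<lambda>f \<in> Arr C. dual_arr (ar F f))\<rparr>"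

type_synonym 's free = "'s \<Rightarrow>\<^sub>0 int"

definition Free_func ::
  "('s set, 's set \<times> ('s \<Rightarrow> 's) \<times> 's set, 's free monoid, ('s free, 's free) ab_arr) func" where
  "Free_func = \<lparr>ob = free_Abelian_group,
     ar = (\<lambda>(S, f, T) \<in> Arr Set_cat.
       (free_Abelian_group S,
        \<lambda>x \<in> carrier (free_Abelian_group S). frag_extend (\<lambda>s. frag_of (f s)) x,
        free_Abelian_group T))\<rparr>"

type_synonym ('o, 'm, 's) sheaf = "('o, 'm, 's free monoid, ('s free, 's free) ab_arr) func"

definition free_abelian_sheaf :: "('o, 'm) cat \<Rightarrow> ('o, 'm, 's) sheaf \<Rightarrow> bool" where
  "free_abelian_sheaf C F \<longleftrightarrow> (\<exists>B. is_functor C Set_cat B \<and> F = comp_func C Free_func B)"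


section \<open>Pairings and factorizations\<close>

definition bilinear_form :: "'g monoid \<Rightarrow> 'h monoid \<Rightarrow> ('g \<times> 'h \<Rightarrow> int) \<Rightarrow> bool" where
  "bilinear_form G H p \<longleftrightarrow>
     p \<in> extensional (carrier G \<times> carrier H) \<and>
     (\<forall>b \<in> carrier H. (\<lambda>a. p (a, b)) \<in> hom G integer_group) \<and>
     (\<forall>a \<in> carrier G. (\<lambda>b. p (a, b)) \<in> hom H integer_group)"

definition pairing :: "('o, 'm) cat \<Rightarrow> ('o, 'm, 'g monoid, ('g, 'g) ab_arr) func
    \<Rightarrow> ('o, 'm, 'h monoid, ('h, 'h) ab_arr) func \<Rightarrow> ('o \<Rightarrow> 'g \<times> 'h \<Rightarrow> int) \<Rightarrow> bool" where
  "pairing C F G p \<longleftrightarrow>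
     p \<in> extensional (Obj C) \<and>
     (\<forall>c \<in> Obj C. bilinear_form (ob F c) (ob G c) (p c)) \<and>
     (\<forall>f \<in> Arr C. \<forall>a \<in> carrier (ob F (Dom C f)). \<forall>b \<in> carrier (ob G (Cod C f)).
        p (Dom C f) (a, fst (snd (ar G f)) b) = p (Cod C f) (fst (snd (ar F f)) a, b))"

definition delta :: "('o, 'm, 'g monoid, ('g, 'g) ab_arr) func
    \<Rightarrow> ('o, 'm, 'h monoid, ('h, 'h) ab_arr) func \<Rightarrow> ('o \<Rightarrow> 'g \<times> 'h \<Rightarrow> int)
    \<Rightarrow> 'o \<Rightarrow> ('h, 'g \<Rightarrow> int) ab_arr" where
  "delta F G p c =
     (ob G c, \<lambda>b \<in> carrier (ob G c). \<lambda>a \<in> carrier (ob F c). p c (a, b), dual_group (ob F c))"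

definition right_nondegenerate :: "('o, 'm) cat \<Rightarrow> ('o, 'm, 'g monoid, ('g, 'g) ab_arr) func
    \<Rightarrow> ('o, 'm, 'h monoid, ('h, 'h) ab_arr) func \<Rightarrow> ('o \<Rightarrow> 'g \<times> 'h \<Rightarrow> int) \<Rightarrow> bool" where
  "right_nondegenerate C F G p \<longleftrightarrow>
     (\<forall>c \<in> Obj C. inj_on (fst (snd (delta F G p c))) (carrier (ob G c)))"

text \<open>Factorizations from a contravariant \<open>P\<close> to a covariant \<open>Q\<close>, and conversely.\<close>

definition factorization_contra_co :: "('o, 'm) cat \<Rightarrow> ('o, 'm, 'g monoid, ('g, 'g) ab_arr) func
    \<Rightarrow> ('o, 'm, 'h monoid, ('h, 'h) ab_arr) func \<Rightarrow> ('o \<Rightarrow> ('g, 'h) ab_arr) \<Rightarrow> bool" where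
  "factorization_contra_co C P Q \<theta> \<longleftrightarrow>
     \<theta> \<in> extensional (Obj C) \<and>
     (\<forall>c \<in> Obj C. \<theta> c \<in> ab_hom (ob P c) (ob Q c)) \<and>
     (\<forall>f \<in> Arr C. \<theta> (Cod C f) = ab_comp (ar Q f) (ab_comp (\<theta> (Dom C f)) (ar P f)))"

definition factorization_co_contra :: "('o, 'm) cat \<Rightarrow> ('o, 'm, 'h monoid, ('h, 'h) ab_arr) func
    \<Rightarrow> ('o, 'm, 'g monoid, ('g, 'g) ab_arr) func \<Rightarrow> ('o \<Rightarrow> ('h, 'g) ab_arr) \<Rightarrow> bool" where
  "factorization_co_contra C Q P \<theta> \<longleftrightarrow>
     \<theta> \<in> extensional (Obj C) \<and>
     (\<forall>c \<in> Obj C. \<theta> c \<in> ab_hom (ob Q c) (ob P c)) \<and>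
     (\<forall>f \<in> Arr C. \<theta> (Dom C f) = ab_comp (ar P f) (ab_comp (\<theta> (Cod C f)) (ar Q f)))"


section \<open>Abstract (quantum) cluster structures\<close>

record ('v, 'x, 'a) acs =
  Ecat :: "('v, 'v spath set) cat"
  Xsh :: "('v, 'v spath set, 'x) sheaf"
  beta :: "'v \<Rightarrow> ('x free, 'a free) ab_arr"
  Ash :: "('v, 'v spath set, 'a) sheaf"
  pair :: "'v \<Rightarrow> 'a free \<times> 'x free \<Rightarrow> int"

definition acs_over :: "'v pair_pre_digraph \<Rightarrow> ('v, 'x, 'a, 'z) acs_scheme \<Rightarrow> bool" where
  "acs_over E S \<longleftrightarrow>
     pair_loopfree_digraph E \<and>
     Ecat S = signed_path_cat E \<and>
     free_abelian_sheaf (opposite (Ecat S)) (Xsh S) \<and>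
     free_abelian_sheaf (Ecat S) (Ash S) \<and>
     factorization_contra_co (Ecat S) (Xsh S) (Ash S) (beta S) \<and>
     pairing (Ecat S) (Ash S) (Xsh S) (pair S) \<and>
     right_nondegenerate (Ecat S) (Ash S) (Xsh S) (pair S)"

record ('v, 'x, 'a) aqcs = "('v, 'x, 'a) acs" +
  lam :: "'v \<Rightarrow> ('a free, 'a free \<Rightarrow> int) ab_arr"

definition aqcs_over :: "'v pair_pre_digraph \<Rightarrow> ('v, 'x, 'a) aqcs \<Rightarrow> bool" where
  "aqcs_over E S \<longleftrightarrow>
     acs_over E S \<and>
     factorization_co_contra (Ecat S) (Ash S) (dual_func (Ecat S) (Ash S)) (lam S) \<and>
     (\<exists>\<rho>. factorization_co_contra (Ecat S) (Ash S) (Xsh S) \<rho> \<and>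
        (\<forall>c \<in> Obj (Ecat S). ab_comp (\<rho> c) (beta S c) = ab_id (ob (Xsh S) c)) \<and>
        (\<forall>c \<in> Obj (Ecat S). lam S c = ab_comp (delta (Ash S) (Xsh S) (pair S) c) (\<rho> c)))"


section \<open>The category AQCS\<close>

record ('v, 'x, 'a) aqcs_mor =
  mfun :: "('v, 'v spath set, 'v, 'v spath set) func"
  mchi :: "'v \<Rightarrow> ('x free, 'x free) ab_arr"
  malpha :: "'v \<Rightarrow> ('a free, 'a free) ab_arr"

text \<open>The functor \<open>F\<^sup>o\<^sup>p\<close> has the same underlying maps as \<open>F\<close>.\<close>

definition aqcs_hom :: "('v, 'x, 'a) aqcs \<Rightarrow> ('v, 'x, 'a) aqcs \<Rightarrow> ('v, 'x, 'a) aqcs_mor set" where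
  "aqcs_hom S T = {m.
     is_functor (Ecat S) (Ecat T) (mfun m) \<and>
     nat_trans (opposite (Ecat S)) Ab_cat (Xsh S)
       (comp_func (opposite (Ecat S)) (Xsh T) (mfun m)) (mchi m) \<and>
     nat_trans (Ecat S) Ab_cat (Ash S) (comp_func (Ecat S) (Ash T) (mfun m)) (malpha m) \<and>
     (\<forall>c \<in> Obj (Ecat S).
        ab_comp (malpha m c) (beta S c) = ab_comp (beta T (ob (mfun m) c)) (mchi m c) \<and>
        lam S c = ab_comp (dual_arr (malpha m c))
          (ab_comp (lam T (ob (mfun m) c)) (malpha m c)))}"

definition aqcs_id :: "('v, 'x, 'a) aqcs \<Rightarrow> ('v, 'x, 'a) aqcs_mor" where
  "aqcs_id S = \<lparr>mfun = id_func (Ecat S),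
     mchi = (\<lambda>c \<in> Obj (Ecat S). ab_id (ob (Xsh S) c)),
     malpha = (\<lambda>c \<in> Obj (Ecat S). ab_id (ob (Ash S) c))\<rparr>"

definition aqcs_comp :: "('v, 'x, 'a) aqcs \<Rightarrow> ('v, 'x, 'a) aqcs_mor \<Rightarrow> ('v, 'x, 'a) aqcs_mor
    \<Rightarrow> ('v, 'x, 'a) aqcs_mor" where
  "aqcs_comp S n m = \<lparr>mfun = comp_func (Ecat S) (mfun n) (mfun m),
     mchi = (\<lambda>c \<in> Obj (Ecat S). ab_comp (mchi n (ob (mfun m) c)) (mchi m c)),
     malpha = (\<lambda>c \<in> Obj (Ecat S). ab_comp (malpha n (ob (mfun m) c)) (malpha m c))\<rparr>"

text \<open>The types \<open>'v\<close>, \<open>'x\<close>, \<open>'a\<close> of vertices and of basis elements of the two sheaves are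
  arbitrary and act as the ambient universe. An arrow is a tuple \<open>(F, \<chi>, \<alpha>)\<close> together with its
  domain and codomain.\<close>

definition AQCS :: "(('v, 'x, 'a) aqcs,
    ('v, 'x, 'a) aqcs \<times> ('v, 'x, 'a) aqcs_mor \<times> ('v, 'x, 'a) aqcs) cat" where
  "AQCS = \<lparr>Obj = {S. \<exists>E. aqcs_over E S},
     Arr = {(S, m, T). (\<exists>E. aqcs_over E S) \<and> (\<exists>E. aqcs_over E T) \<and> m \<in> aqcs_hom S T},
     Dom = (\<lambda>(S, m, T). S), Cod = (\<lambda>(S, m, T). T), Id = (\<lambda>S. (S, aqcs_id S, S)),
     Comp = (\<lambda>(T', n, U) (S, m, T). (S, aqcs_comp S n m, U))\<rparr>"

text \<open>The structure over the empty graph. Since \<open>Obj\<close> and \<open>Arr\<close> of its base are empty, the only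
  extensional map on them is \<^term>\<open>\<lambda>_. undefined\<close>.\<close>

definition empty_digraph :: "'v pair_pre_digraph" where
  "empty_digraph = \<lparr>pverts = {}, parcs = {}\<rparr>"

definition empty_func :: "('o1, 'm1, 'o2, 'm2) func" where
  "empty_func = \<lparr>ob = (\<lambda>_. undefined), ar = (\<lambda>_. undefined)\<rparr>"

definition empty_aqcs :: "('v, 'x, 'a) aqcs" where
  "empty_aqcs = \<lparr>Ecat = signed_path_cat empty_digraph, Xsh = empty_func, beta = (\<lambda>_. undefined),
     Ash = empty_func, pair = (\<lambda>_. undefined), lam = (\<lambda>_. undefined)\<rparr>"


section \<open>AQCS is a category\<close>

lemma category_opposite:
  assumes "category C" shows "category (opposite C)"
proof -
  interpret category C by fact
  show ?thesis
    using dom_in cod_in id_hom comp_hom id_left id_right comp_assoc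
    by unfold_locales (auto simp: opposite_def Hom_def)
qed

lemma category_path_cat:
  assumes "wf_digraph G" shows "category (path_cat G)"
proof -
  interpret wf_digraph G by fact
  show ?thesis
    by unfold_locales
      (auto simp: path_cat_def Hom_def awalk_Nil_iff intro: awalkI_apath awalk_appendI)
qed

lemma category_quotient_cat:
  assumes "category C"
    and R: "\<And>f g. (f, g) \<in> R \<Longrightarrow> f \<in> Arr C \<and> g \<in> Arr C \<and> Dom C f = Dom C g \<and> Cod C f = Cod C g"
  shows "category (quotient_cat C R)"
proof -
  interpret category C by fact
  let ?r = "congr_rel C R"
  let ?cl = "\<lambda>f. ?r `` {f}"
  have par: "f \<in> Arr C \<and> g \<in> Arr C \<and> Dom C f = Dom C g \<and> Cod C f = Cod C g"
    if "congr C R f g" for f g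
    using that
  proof induction
    case (comp f f' g g')
    then show ?case using comp_hom[of f g] comp_hom[of f' g'] by (auto simp: Hom_def)
  qed (auto dest: R)
  have eq: "equiv (Arr C) ?r"
    by (rule equivI)
      (auto simp: refl_on_def sym_def trans_def congr_rel_def intro: congr.intros dest: par)
  have cl_eq: "?cl f = ?cl g" if "congr C R f g" for f g
    using equiv_class_eq[OF eq] that by (auto simp: congr_rel_def)
  have self: "f \<in> ?cl f" if "f \<in> Arr C" for f
    using that by (auto simp: congr_rel_def intro: congr.refl)
  have arr: "K \<in> Arr (quotient_cat C R) \<longleftrightarrow> (\<exists>f \<in> Arr C. K = ?cl f)" for K
    by (auto simp: quotient_cat_def quotient_def)
  have dom: "Dom (quotient_cat C R) (?cl f) = Dom C f" if "f \<in> Arr C" for f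
  proof -
    have "Dom C ` ?cl f = {Dom C f}" using self[OF that] by (auto simp: congr_rel_def dest: par)
    then show ?thesis by (simp add: quotient_cat_def)
  qed
  have cod: "Cod (quotient_cat C R) (?cl f) = Cod C f" if "f \<in> Arr C" for f
  proof -
    have "Cod C ` ?cl f = {Cod C f}" using self[OF that] by (auto simp: congr_rel_def dest: par)
    then show ?thesis by (simp add: quotient_cat_def)
  qed
  have cmp: "Comp (quotient_cat C R) (?cl g) (?cl f) = ?cl (Comp C g f)"
    if "f \<in> Arr C" "g \<in> Arr C" "Dom C g = Cod C f" for f g
  proof -
    have "?cl (Comp C g' f') = ?cl (Comp C g f)" if "g' \<in> ?cl g" "f' \<in> ?cl f" for g' f'
      using that \<open>Dom C g = Cod C f\<close>
      by (intro cl_eq congr.comp[THEN congr.sym]) (auto simp: congr_rel_def dest: par)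
    then show ?thesis using self[OF that(1)] self[OF that(2)]
      unfolding quotient_cat_def cat.simps by blast
  qed
  have id: "Id (quotient_cat C R) a = ?cl (Id C a)" for a by (simp add: quotient_cat_def)
  have obj: "Obj (quotient_cat C R) = Obj C" by (simp add: quotient_cat_def)
  have idh: "Id C a \<in> Arr C" "Dom C (Id C a) = a" "Cod C (Id C a) = a" if "a \<in> Obj C" for a
    using id_hom[OF that] by (auto simp: Hom_def)
  have cmph: "Comp C g f \<in> Arr C" "Dom C (Comp C g f) = Dom C f" "Cod C (Comp C g f) = Cod C g"
    if "f \<in> Arr C" "g \<in> Arr C" "Dom C g = Cod C f" for f g
    using comp_hom[OF that] by (auto simp: Hom_def)
  show ?thesis
  proof
    fix f g h assume "f \<in> Arr (quotient_cat C R)" "g \<in> Arr (quotient_cat C R)"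
      "h \<in> Arr (quotient_cat C R)"
      and d: "Dom (quotient_cat C R) g = Cod (quotient_cat C R) f"
      "Dom (quotient_cat C R) h = Cod (quotient_cat C R) g"
    then obtain f' g' h' where "f' \<in> Arr C" "g' \<in> Arr C" "h' \<in> Arr C"
      "f = ?cl f'" "g = ?cl g'" "h = ?cl h'" by (auto simp: arr)
    with d show "Comp (quotient_cat C R) h (Comp (quotient_cat C R) g f) =
      Comp (quotient_cat C R) (Comp (quotient_cat C R) h g) f"
      by (simp add: dom cod cmp cmph comp_assoc)
  next
    fix f g assume "f \<in> Arr (quotient_cat C R)" "g \<in> Arr (quotient_cat C R)"
      and d: "Dom (quotient_cat C R) g = Cod (quotient_cat C R) f"
    then obtain f' g' where "f' \<in> Arr C" "g' \<in> Arr C" "f = ?cl f'" "g = ?cl g'"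
      by (auto simp: arr)
    with d show "Comp (quotient_cat C R) g f \<in>
      Hom (quotient_cat C R) (Dom (quotient_cat C R) f) (Cod (quotient_cat C R) g)"
      by (auto simp: Hom_def dom cod cmp cmph arr)
  next
    fix a assume "a \<in> Obj (quotient_cat C R)"
    then show "Id (quotient_cat C R) a \<in> Hom (quotient_cat C R) a a"
      by (auto simp: Hom_def obj id idh dom cod arr)
  qed (auto simp: arr obj dom cod id cmp idh dom_in cod_in id_left id_right)
qed

lemma category_signed_path_cat:
  assumes "pair_wf_digraph E" shows "category (signed_path_cat E)"
proof -
  interpret E: pair_wf_digraph E by fact
  interpret S: wf_digraph "signed_digraph E"
    by unfold_locales
      (auto simp: signed_digraph_def dest: E.arc_fst_in_verts E.arc_snd_in_verts)
  have "category (path_cat (signed_digraph E))"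
    by (rule category_path_cat) unfold_locales
  then show ?thesis
    unfolding signed_path_cat_def
  proof (rule category_quotient_cat)
    fix f g assume "(f, g) \<in> signed_rel E"
    then show "f \<in> Arr (path_cat (signed_digraph E)) \<and> g \<in> Arr (path_cat (signed_digraph E)) \<and>
       Dom (path_cat (signed_digraph E)) f = Dom (path_cat (signed_digraph E)) g \<and>
       Cod (path_cat (signed_digraph E)) f = Cod (path_cat (signed_digraph E)) g"
      by (auto simp: signed_rel_def path_cat_def signed_digraph_def pre_digraph.awalk_def
          pre_digraph.cas.simps dest: E.arc_fst_in_verts E.arc_snd_in_verts)
  qed
qed

lemma category_Set_cat: "category Set_cat"
  by unfold_locales
    (auto simp: Set_cat_def Hom_def compose_assoc[symmetric] Id_compose compose_Id PiE_def compose_eq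
      Pi_iff)

lemma ab_id_hom: "comm_group G \<Longrightarrow> ab_id G \<in> ab_hom G G"
  by (auto simp: ab_id_def ab_hom_def hom_def comm_group_def group_def monoid.m_closed)

lemma ab_comp_hom: "f \<in> ab_hom G H \<Longrightarrow> g \<in> ab_hom H K \<Longrightarrow> ab_comp g f \<in> ab_hom G K"
proof -
  assume "f \<in> ab_hom G H" "g \<in> ab_hom H K"
  then obtain f' g' where f: "f = (G, f', H)" "comm_group G" "f' \<in> hom G H"
    and g: "g = (H, g', K)" "comm_group K" "g' \<in> hom H K"
    by (auto simp: ab_hom_def)
  interpret comm_group G by fact
  have "compose (carrier G) g' f' \<in> hom G K"
    using f(3) g(3) by (auto simp: hom_def compose_def Pi_iff)
  then show ?thesis using f g by (auto simp: ab_hom_def)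
qed

lemma ab_comp_id_left: "f \<in> ab_hom G H \<Longrightarrow> ab_comp (ab_id H) f = f"
  by (auto simp: ab_hom_def ab_id_def compose_def hom_def extensional_def fun_eq_iff Pi_iff)

lemma ab_comp_id_right: "f \<in> ab_hom G H \<Longrightarrow> ab_comp f (ab_id G) = f"
  by (auto simp: ab_hom_def ab_id_def compose_def hom_def extensional_def fun_eq_iff Pi_iff)

lemma ab_comp_assoc:
  "f \<in> ab_hom G H \<Longrightarrow> g \<in> ab_hom H K \<Longrightarrow> h \<in> ab_hom K L \<Longrightarrow>
    ab_comp h (ab_comp g f) = ab_comp (ab_comp h g) f"
  by (auto simp: ab_hom_def compose_def hom_def fun_eq_iff Pi_iff)

lemma Hom_Ab_cat: "Hom Ab_cat G H = ab_hom G H"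
  by (auto simp: Hom_def Ab_cat_def ab_hom_def)

lemma category_Ab_cat: "category Ab_cat"
proof -
  have arr: "f \<in> ab_hom (Dom Ab_cat f) (Cod Ab_cat f)" if "f \<in> Arr Ab_cat" for f :: "('g,'g) ab_arr"
    using that by (auto simp: Ab_cat_def)
  have s: "Comp Ab_cat = ab_comp" "Id Ab_cat = ab_id" by (simp_all add: Ab_cat_def)
  show ?thesis
  proof
    fix f g :: "('g,'g) ab_arr"
    assume f: "f \<in> Arr Ab_cat" and g: "g \<in> Arr Ab_cat" and d: "Dom Ab_cat g = Cod Ab_cat f"
    show "Comp Ab_cat g f \<in> Hom Ab_cat (Dom Ab_cat f) (Cod Ab_cat g)"
      unfolding Hom_Ab_cat s using ab_comp_hom[OF arr[OF f]] arr[OF g] d by simp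
  next
    fix f g h :: "('g,'g) ab_arr"
    assume f: "f \<in> Arr Ab_cat" and g: "g \<in> Arr Ab_cat" and h: "h \<in> Arr Ab_cat"
      and d: "Dom Ab_cat g = Cod Ab_cat f" "Dom Ab_cat h = Cod Ab_cat g"
    show "Comp Ab_cat h (Comp Ab_cat g f) = Comp Ab_cat (Comp Ab_cat h g) f"
      unfolding s using ab_comp_assoc[OF arr[OF f]] arr[OF g] arr[OF h] d by simp
  next
    fix a :: "'g monoid" assume "a \<in> Obj Ab_cat"
    then show "Id Ab_cat a \<in> Hom Ab_cat a a"
      unfolding Hom_Ab_cat s by (auto intro!: ab_id_hom simp: Ab_cat_def)
  next
    fix f :: "('g,'g) ab_arr" assume f: "f \<in> Arr Ab_cat"
    show "Comp Ab_cat (Id Ab_cat (Cod Ab_cat f)) f = f"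
      unfolding s by (rule ab_comp_id_left[OF arr[OF f]])
    show "Comp Ab_cat f (Id Ab_cat (Dom Ab_cat f)) = f"
      unfolding s by (rule ab_comp_id_right[OF arr[OF f]])
  qed (auto simp: Ab_cat_def ab_hom_def)
qed

lemma frag_extend_frag_of_id: "frag_extend (\<lambda>s. frag_of s) x = x"
  by (metis frag_expansion)

lemma frag_extend_in_carrier:
  assumes "f \<in> S \<rightarrow> T" "x \<in> carrier (free_Abelian_group S)"
  shows "frag_extend (\<lambda>s. frag_of (f s)) x \<in> carrier (free_Abelian_group T)"
proof -
  have "Poly_Mapping.keys (frag_extend (\<lambda>s. frag_of (f s)) x) \<subseteq> (\<Union>s \<in> Poly_Mapping.keys x. {f s})"
    by (rule order_trans[OF keys_frag_extend]) (auto simp: keys_frag_of)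
  then show ?thesis using assms by (auto simp: carrier_free_Abelian_group_iff)
qed

lemma is_functor_Free_func: "is_functor Set_cat Ab_cat Free_func"
proof -
  have hom: "(free_Abelian_group S,
      \<lambda>x \<in> carrier (free_Abelian_group S). frag_extend (\<lambda>s. frag_of (f s)) x,
      free_Abelian_group T) \<in> ab_hom (free_Abelian_group S) (free_Abelian_group T)"
    if "f \<in> S \<rightarrow>\<^sub>E T" for f :: "'a \<Rightarrow> 'b" and S T
  proof -
    have f: "f \<in> S \<rightarrow> T" using that by auto
    interpret S: comm_group "free_Abelian_group S" by (rule abelian_free_Abelian_group)
    show ?thesis
      using frag_extend_in_carrier[OF f] S.m_closed
      by (auto simp: ab_hom_def hom_def abelian_free_Abelian_group frag_extend_add
          simp del: carrier_free_Abelian_group_iff)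
  qed
  have comp: "frag_extend (\<lambda>s. frag_of (compose S g f s)) x =
      frag_extend (\<lambda>s. frag_of (g s)) (frag_extend (\<lambda>s. frag_of (f s)) x)"
    if "x \<in> carrier (free_Abelian_group S)" for x :: "'a free" and f :: "'a \<Rightarrow> 'b" and g :: "'b \<Rightarrow> 'c" and S
  proof -
    have "Poly_Mapping.keys x \<subseteq> S" using that by simp
    then show ?thesis
      by (induction x rule: frag_induction)
        (simp_all add: frag_extend_diff compose_eq)
  qed
  have idc: "frag_extend (\<lambda>s. frag_of (if s \<in> S then s else undefined)) x = x"
    if "Poly_Mapping.keys x \<subseteq> S" for x :: "'a free" and S
    using that by (induction x rule: frag_induction) (simp_all add: frag_extend_diff)
  show ?thesis
    unfolding is_functor_def
  proof (intro conjI ballI impI)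
    fix f g :: "'a set \<times> ('a \<Rightarrow> 'a) \<times> 'a set"
    assume f: "f \<in> Arr Set_cat" and g: "g \<in> Arr Set_cat" and d: "Dom Set_cat g = Cod Set_cat f"
    obtain S f' T g' U where fg: "f = (S, f', T)" "g = (T, g', U)" "f' \<in> S \<rightarrow>\<^sub>E T" "g' \<in> T \<rightarrow>\<^sub>E U"
      using f g d by (auto simp: Set_cat_def)
    then have "f' \<in> S \<rightarrow> T" by auto
    note c = frag_extend_in_carrier[OF this]
    have "compose S g' f' \<in> S \<rightarrow>\<^sub>E U" using fg by (auto simp: compose_def)
    then have 1: "Comp Set_cat g f \<in> Arr Set_cat" "Comp Set_cat g f = (S, compose S g' f', U)"
      using fg by (auto simp: Set_cat_def)
    show "ar Free_func (Comp Set_cat g f) = Comp Ab_cat (ar Free_func g) (ar Free_func f)"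
      using f g c comp[of _ S g' f'] unfolding 1(2) using 1(1)[unfolded 1(2)] unfolding fg
      by (auto simp: Free_func_def Ab_cat_def compose_def fun_eq_iff simp del: carrier_free_Abelian_group_iff)
  next
    fix f :: "'a set \<times> ('a \<Rightarrow> 'a) \<times> 'a set" assume "f \<in> Arr Set_cat"
    then show "ar Free_func f \<in>
        Hom Ab_cat (ob Free_func (Dom Set_cat f)) (ob Free_func (Cod Set_cat f))"
      unfolding Hom_Ab_cat using hom by (auto simp: Free_func_def Set_cat_def)
  next
    show "ar Free_func \<in> extensional (Arr Set_cat)" by (simp add: Free_func_def)
  qed (auto simp: Free_func_def Set_cat_def Ab_cat_def abelian_free_Abelian_group
      ab_id_def fun_eq_iff idc restrict_def)
qed

lemma is_functor_comp_func:
  assumes C: "category C" and F: "is_functor C D F" and G: "is_functor D E' G"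
  shows "is_functor C E' (comp_func C G F)"
proof -
  interpret category C by fact
  have "f \<in> Arr C \<Longrightarrow> ar F f \<in> Arr D \<and> Dom D (ar F f) = ob F (Dom C f) \<and>
      Cod D (ar F f) = ob F (Cod C f)" for f
    using F by (auto simp: is_functor_def Hom_def)
  then show ?thesis
    using F G dom_in cod_in id_hom comp_hom
    unfolding is_functor_def comp_func_def
    by (auto simp: compose_def Hom_def)
qed

lemma is_functor_id_func:
  assumes C: "category C" shows "is_functor C C (id_func C)"
proof -
  interpret category C by fact
  show ?thesis using dom_in cod_in id_hom comp_hom
    by (auto simp: is_functor_def id_func_def Hom_def)
qed

lemma comm_group_dual_group:
  assumes "comm_group G" shows "comm_group (dual_group G)"
proof -
  interpret comm_group G by fact
  show ?thesis
  proof (rule comm_groupI)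
    fix \<phi> assume p: "\<phi> \<in> carrier (dual_group G)"
    show "\<exists>\<psi> \<in> carrier (dual_group G). \<psi> \<otimes>\<^bsub>dual_group G\<^esub> \<phi> = \<one>\<^bsub>dual_group G\<^esub>"
      using p by (intro bexI[of _ "\<lambda>x \<in> carrier G. - \<phi> x"])
        (auto simp: dual_group_def hom_def Pi_iff fun_eq_iff)
  qed (auto simp: dual_group_def hom_def Pi_iff fun_eq_iff restrict_def extensional_def)
qed

lemma dual_arr_hom:
  assumes "f \<in> ab_hom G H" shows "dual_arr f \<in> ab_hom (dual_group H) (dual_group G)"
proof -
  obtain f' where f: "f = (G, f', H)" "comm_group G" "comm_group H" "f' \<in> hom G H"
    using assms by (auto simp: ab_hom_def)
  interpret G: comm_group G by fact
  interpret H: comm_group H by fact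
  have "compose (carrier G) \<phi> f' \<in> carrier (dual_group G)" if "\<phi> \<in> carrier (dual_group H)" for \<phi>
    using that f(4) by (auto simp: dual_group_def hom_def Pi_iff compose_def)
  moreover have "\<phi> \<otimes>\<^bsub>dual_group H\<^esub> \<psi> \<in> carrier (dual_group H)"
    if "\<phi> \<in> carrier (dual_group H)" "\<psi> \<in> carrier (dual_group H)" for \<phi> \<psi>
    using that comm_group_dual_group[OF f(3)]
    by (simp add: comm_group_def group_def monoid.m_closed)
  moreover have "compose (carrier G) (\<phi> \<otimes>\<^bsub>dual_group H\<^esub> \<psi>) f' =
      compose (carrier G) \<phi> f' \<otimes>\<^bsub>dual_group G\<^esub> compose (carrier G) \<psi> f'" for \<phi> \<psi>
    using f(4) by (auto simp: dual_group_def hom_def Pi_iff compose_def fun_eq_iff)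
  ultimately show ?thesis
    by (simp add: ab_hom_def f comm_group_dual_group hom_def)
qed

lemma dual_arr_comp:
  "f \<in> ab_hom G H \<Longrightarrow> g \<in> ab_hom H K \<Longrightarrow> dual_arr (ab_comp g f) = ab_comp (dual_arr f) (dual_arr g)"
proof -
  assume "f \<in> ab_hom G H" and g: "g \<in> ab_hom H K"
  then obtain f' g' where f: "f = (G, f', H)" "f' \<in> carrier G \<rightarrow> carrier H"
    and g': "g = (H, g', K)" by (auto simp: ab_hom_def hom_def)
  have "compose (carrier H) \<phi> g' \<in> carrier (dual_group H)" if "\<phi> \<in> carrier (dual_group K)" for \<phi>
    using dual_arr_hom[OF g] that unfolding g' by (auto simp: ab_hom_def hom_def Pi_iff)
  then show ?thesis
    using f(2) unfolding f g' dual_arr.simps ab_comp.simps compose_def[of "carrier (dual_group K)"]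
    by (auto simp: compose_assoc[symmetric] intro!: restrict_ext)
qed

lemma dual_arr_id: "dual_arr (ab_id G) = ab_id (dual_group G)"
  by (auto simp: ab_id_def dual_group_def compose_def extensional_def fun_eq_iff)

lemma nat_transD:
  assumes "nat_trans C Ab_cat F G \<eta>"
  shows "c \<in> Obj C \<Longrightarrow> \<eta> c \<in> ab_hom (ob F c) (ob G c)"
    and "f \<in> Arr C \<Longrightarrow> ab_comp (ar G f) (\<eta> (Dom C f)) = ab_comp (\<eta> (Cod C f)) (ar F f)"
    and "\<eta> \<in> extensional (Obj C)"
  using assms by (auto simp: nat_trans_def Hom_Ab_cat) (simp add: Ab_cat_def)

lemma functor_AbD:
  assumes "is_functor C Ab_cat F"
  shows "c \<in> Obj C \<Longrightarrow> comm_group (ob F c)"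
    and "f \<in> Arr C \<Longrightarrow> ar F f \<in> ab_hom (ob F (Dom C f)) (ob F (Cod C f))"
  using assms by (auto simp: is_functor_def Hom_Ab_cat) (simp add: Ab_cat_def)

lemma free_abelian_sheafD:
  "category C \<Longrightarrow> free_abelian_sheaf C F \<Longrightarrow> is_functor C Ab_cat F"
  by (auto simp: free_abelian_sheaf_def intro: is_functor_comp_func is_functor_Free_func)

lemma nat_trans_id:
  assumes C: "category C" and F: "is_functor C Ab_cat F"
  shows "nat_trans C Ab_cat F (comp_func C F (id_func C)) (\<lambda>c \<in> Obj C. ab_id (ob F c))"
proof -
  interpret category C by fact
  show ?thesis
    using functor_AbD[OF F] dom_in cod_in ab_comp_id_left[OF functor_AbD(2)[OF F]]
      ab_comp_id_right[OF functor_AbD(2)[OF F]]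
    unfolding nat_trans_def Hom_Ab_cat
    by (auto simp: comp_func_def id_func_def Ab_cat_def compose_def ab_id_hom)
qed

lemma nat_trans_comp:
  assumes C: "category C" and F: "is_functor C D F" and F': "is_functor D E' F'"
    and X: "is_functor C Ab_cat X" and Y: "is_functor D Ab_cat Y" and Z: "is_functor E' Ab_cat Z"
    and n: "nat_trans C Ab_cat X (comp_func C Y F) \<eta>"
    and n': "nat_trans D Ab_cat Y (comp_func D Z F') \<eta>'"
  shows "nat_trans C Ab_cat X (comp_func C Z (comp_func C F' F))
    (\<lambda>c \<in> Obj C. ab_comp (\<eta>' (ob F c)) (\<eta> c))"
proof -
  interpret category C by fact
  have Fo: "ob F c \<in> Obj D" if "c \<in> Obj C" for c using F that by (auto simp: is_functor_def)
  have Fa: "ar F f \<in> Arr D" "Dom D (ar F f) = ob F (Dom C f)" "Cod D (ar F f) = ob F (Cod C f)"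
    if "f \<in> Arr C" for f using F that by (auto simp: is_functor_def Hom_def)
  have e: "\<eta> c \<in> ab_hom (ob X c) (ob Y (ob F c))" if "c \<in> Obj C" for c
    using nat_transD(1)[OF n that] that by (simp add: comp_func_def compose_eq)
  have e': "\<eta>' c \<in> ab_hom (ob Y c) (ob Z (ob F' c))" if "c \<in> Obj D" for c
    using nat_transD(1)[OF n' that] that by (simp add: comp_func_def compose_eq)
  have sq: "ab_comp (ar Z (ar F' (ar F f))) (ab_comp (\<eta>' (ob F (Dom C f))) (\<eta> (Dom C f))) =
      ab_comp (ab_comp (\<eta>' (ob F (Cod C f))) (\<eta> (Cod C f))) (ar X f)" if f: "f \<in> Arr C" for f
  proof -
    have z: "ar Z (ar F' (ar F f)) \<in>
        ab_hom (ob Z (ob F' (ob F (Dom C f)))) (ob Z (ob F' (ob F (Cod C f))))"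
      using functor_AbD(2)[OF Z, of "ar F' (ar F f)"] F' Fa[OF f]
      by (auto simp: is_functor_def Hom_def)
    have y: "ar Y (ar F f) \<in> ab_hom (ob Y (ob F (Dom C f))) (ob Y (ob F (Cod C f)))"
      using functor_AbD(2)[OF Y Fa(1)[OF f]] by (simp add: Fa(2,3)[OF f])
    note x = functor_AbD(2)[OF X f]
    note d = dom_in[OF f] and c = cod_in[OF f]
    have s1: "ab_comp (ar Y (ar F f)) (\<eta> (Dom C f)) = ab_comp (\<eta> (Cod C f)) (ar X f)"
      using nat_transD(2)[OF n f] f by (simp add: comp_func_def compose_eq)
    have s2: "ab_comp (ar Z (ar F' (ar F f))) (\<eta>' (ob F (Dom C f))) =
        ab_comp (\<eta>' (ob F (Cod C f))) (ar Y (ar F f))"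
      using nat_transD(2)[OF n' Fa(1)[OF f]] Fa[OF f] by (simp add: comp_func_def compose_eq)
    show ?thesis
      using ab_comp_assoc[OF e[OF d] e'[OF Fo[OF d]] z] ab_comp_assoc[OF x e[OF c] e'[OF Fo[OF c]]]
        ab_comp_assoc[OF e[OF d] y e'[OF Fo[OF c]]] s1 s2 by simp
  qed
  show ?thesis
    unfolding nat_trans_def Hom_Ab_cat
    using sq ab_comp_hom[OF e e'[OF Fo]] dom_in cod_in
    by (auto simp: comp_func_def compose_def Ab_cat_def)
qed

lemma aqcs_overD:
  assumes "aqcs_over E S"
  shows "category (Ecat S)" "category (opposite (Ecat S))"
    and "is_functor (opposite (Ecat S)) Ab_cat (Xsh S)" "is_functor (Ecat S) Ab_cat (Ash S)"
    and "c \<in> Obj (Ecat S) \<Longrightarrow> beta S c \<in> ab_hom (ob (Xsh S) c) (ob (Ash S) c)"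
    and "c \<in> Obj (Ecat S) \<Longrightarrow> lam S c \<in> ab_hom (ob (Ash S) c) (dual_group (ob (Ash S) c))"
proof -
  have E: "pair_loopfree_digraph E" and S: "Ecat S = signed_path_cat E"
    using assms by (auto simp: aqcs_over_def acs_over_def)
  show 1: "category (Ecat S)"
    unfolding S using E by (intro category_signed_path_cat) (simp add: pair_loopfree_digraph_def)
  show 2: "category (opposite (Ecat S))" by (rule category_opposite[OF 1])
  show "is_functor (opposite (Ecat S)) Ab_cat (Xsh S)" "is_functor (Ecat S) Ab_cat (Ash S)"
    using assms free_abelian_sheafD[OF 1] free_abelian_sheafD[OF 2]
    by (auto simp: aqcs_over_def acs_over_def)
  show "beta S c \<in> ab_hom (ob (Xsh S) c) (ob (Ash S) c)"
    "lam S c \<in> ab_hom (ob (Ash S) c) (dual_group (ob (Ash S) c))" if "c \<in> Obj (Ecat S)"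
    using assms that by (auto simp: aqcs_over_def acs_over_def factorization_contra_co_def
        factorization_co_contra_def dual_func_def)
qed

lemma opposite_simps [simp]:
  "Obj (opposite C) = Obj C" "Arr (opposite C) = Arr C" "id_func (opposite C) = id_func C"
  "comp_func (opposite C) = comp_func C"
  by (auto simp: opposite_def id_func_def comp_func_def fun_eq_iff)

lemma is_functor_opposite: "is_functor C D F \<Longrightarrow> is_functor (opposite C) (opposite D) F"
  by (auto simp: is_functor_def opposite_def Hom_def)

lemma aqcs_homD:
  assumes "aqcs_over E S" "aqcs_over E' T" "m \<in> aqcs_hom S T"
  shows "is_functor (Ecat S) (Ecat T) (mfun m)"
    "nat_trans (opposite (Ecat S)) Ab_cat (Xsh S) (comp_func (Ecat S) (Xsh T) (mfun m)) (mchi m)"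
    "nat_trans (Ecat S) Ab_cat (Ash S) (comp_func (Ecat S) (Ash T) (mfun m)) (malpha m)"
    "c \<in> Obj (Ecat S) \<Longrightarrow> ob (mfun m) c \<in> Obj (Ecat T)"
    "c \<in> Obj (Ecat S) \<Longrightarrow> mchi m c \<in> ab_hom (ob (Xsh S) c) (ob (Xsh T) (ob (mfun m) c))"
    "c \<in> Obj (Ecat S) \<Longrightarrow> malpha m c \<in> ab_hom (ob (Ash S) c) (ob (Ash T) (ob (mfun m) c))"
    "c \<in> Obj (Ecat S) \<Longrightarrow>
      ab_comp (malpha m c) (beta S c) = ab_comp (beta T (ob (mfun m) c)) (mchi m c)"
    "c \<in> Obj (Ecat S) \<Longrightarrow>
      lam S c = ab_comp (dual_arr (malpha m c)) (ab_comp (lam T (ob (mfun m) c)) (malpha m c))"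
proof -
  show 1: "is_functor (Ecat S) (Ecat T) (mfun m)"
    "nat_trans (opposite (Ecat S)) Ab_cat (Xsh S) (comp_func (Ecat S) (Xsh T) (mfun m)) (mchi m)"
    "nat_trans (Ecat S) Ab_cat (Ash S) (comp_func (Ecat S) (Ash T) (mfun m)) (malpha m)"
    using assms(3) by (auto simp: aqcs_hom_def)
  assume c: "c \<in> Obj (Ecat S)"
  show "ob (mfun m) c \<in> Obj (Ecat T)" using 1(1) c by (auto simp: is_functor_def)
  show "mchi m c \<in> ab_hom (ob (Xsh S) c) (ob (Xsh T) (ob (mfun m) c))"
    using nat_transD(1)[OF 1(2), of c] c by (simp add: comp_func_def compose_eq)
  show "malpha m c \<in> ab_hom (ob (Ash S) c) (ob (Ash T) (ob (mfun m) c))"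
    using nat_transD(1)[OF 1(3), of c] c by (simp add: comp_func_def compose_eq)
qed (use assms(3) in \<open>auto simp: aqcs_hom_def\<close>)

lemma aqcs_id_hom:
  assumes S: "aqcs_over E S" shows "aqcs_id S \<in> aqcs_hom S S"
proof -
  note D = aqcs_overD[OF S]
  show ?thesis
    unfolding aqcs_hom_def mem_Collect_eq
  proof (intro conjI ballI)
    show "is_functor (Ecat S) (Ecat S) (mfun (aqcs_id S))"
      by (simp add: aqcs_id_def is_functor_id_func[OF D(1)])
    show "nat_trans (opposite (Ecat S)) Ab_cat (Xsh S)
        (comp_func (opposite (Ecat S)) (Xsh S) (mfun (aqcs_id S))) (mchi (aqcs_id S))"
      using nat_trans_id[OF D(2,3)] by (simp add: aqcs_id_def)
    show "nat_trans (Ecat S) Ab_cat (Ash S)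
        (comp_func (Ecat S) (Ash S) (mfun (aqcs_id S))) (malpha (aqcs_id S))"
      using nat_trans_id[OF D(1,4)] by (simp add: aqcs_id_def)
    fix c assume c: "c \<in> Obj (Ecat S)"
    show "ab_comp (malpha (aqcs_id S) c) (beta S c) =
        ab_comp (beta S (ob (mfun (aqcs_id S)) c)) (mchi (aqcs_id S) c)"
      using c ab_comp_id_left[OF D(5)[OF c]] ab_comp_id_right[OF D(5)[OF c]]
      by (simp add: aqcs_id_def id_func_def)
    show "lam S c = ab_comp (dual_arr (malpha (aqcs_id S) c))
        (ab_comp (lam S (ob (mfun (aqcs_id S)) c)) (malpha (aqcs_id S) c))"
      using c ab_comp_id_left[OF D(6)[OF c]] ab_comp_id_right[OF D(6)[OF c]]
      by (simp add: aqcs_id_def id_func_def dual_arr_id)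
  qed
qed

lemma aqcs_comp_hom:
  assumes S: "aqcs_over E S" and T: "aqcs_over E' T" and U: "aqcs_over E'' U"
    and m: "m \<in> aqcs_hom S T" and n: "n \<in> aqcs_hom T U"
  shows "aqcs_comp S n m \<in> aqcs_hom S U"
proof -
  note DS = aqcs_overD[OF S] and DT = aqcs_overD[OF T] and DU = aqcs_overD[OF U]
  note M = aqcs_homD[OF S T m] and N = aqcs_homD[OF T U n]
  show ?thesis
    unfolding aqcs_hom_def mem_Collect_eq
  proof (intro conjI ballI)
    show "is_functor (Ecat S) (Ecat U) (mfun (aqcs_comp S n m))"
      using is_functor_comp_func[OF DS(1) M(1) N(1)] by (simp add: aqcs_comp_def)
    show "nat_trans (opposite (Ecat S)) Ab_cat (Xsh S)
        (comp_func (opposite (Ecat S)) (Xsh U) (mfun (aqcs_comp S n m))) (mchi (aqcs_comp S n m))"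
      using nat_trans_comp[OF DS(2) is_functor_opposite[OF M(1)] is_functor_opposite[OF N(1)]
          DS(3) DT(3) DU(3)] M(2) N(2) by (simp add: aqcs_comp_def)
    show "nat_trans (Ecat S) Ab_cat (Ash S)
        (comp_func (Ecat S) (Ash U) (mfun (aqcs_comp S n m))) (malpha (aqcs_comp S n m))"
      using nat_trans_comp[OF DS(1) M(1) N(1) DS(4) DT(4) DU(4) M(3) N(3)]
      by (simp add: aqcs_comp_def)
    fix c assume c: "c \<in> Obj (Ecat S)"
    let ?d = "ob (mfun m) c" let ?e = "ob (mfun n) ?d"
    note d = M(4)[OF c] note e = N(4)[OF d]
    note mc = M(5)[OF c] and ma = M(6)[OF c] and nc = N(5)[OF d] and na = N(6)[OF d]
    have "ab_comp (ab_comp (malpha n ?d) (malpha m c)) (beta S c) =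
        ab_comp (malpha n ?d) (ab_comp (beta T ?d) (mchi m c))"
      by (simp add: ab_comp_assoc[OF DS(5)[OF c] ma na, symmetric] M(7)[OF c])
    also have "\<dots> = ab_comp (beta U ?e) (ab_comp (mchi n ?d) (mchi m c))"
      by (simp add: ab_comp_assoc[OF mc DT(5)[OF d] na] N(7)[OF d]
          ab_comp_assoc[OF mc nc DU(5)[OF e]])
    finally show "ab_comp (malpha (aqcs_comp S n m) c) (beta S c) =
        ab_comp (beta U (ob (mfun (aqcs_comp S n m)) c)) (mchi (aqcs_comp S n m) c)"
      using c by (simp add: aqcs_comp_def comp_func_def compose_eq)
    note ma' = dual_arr_hom[OF ma] and na' = dual_arr_hom[OF na]
    note l = DU(6)[OF e] note ln = ab_comp_hom[OF na l]
    have "lam S c = ab_comp (dual_arr (malpha m c)) (ab_comp (lam T ?d) (malpha m c))"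
      by (rule M(8)[OF c])
    also have "ab_comp (lam T ?d) (malpha m c) =
        ab_comp (dual_arr (malpha n ?d)) (ab_comp (lam U ?e) (ab_comp (malpha n ?d) (malpha m c)))"
      by (subst N(8)[OF d]) (simp add: ab_comp_assoc[OF ma ln na'] ab_comp_assoc[OF ma na l])
    also have "ab_comp (dual_arr (malpha m c)) \<dots> =
        ab_comp (dual_arr (ab_comp (malpha n ?d) (malpha m c)))
          (ab_comp (lam U ?e) (ab_comp (malpha n ?d) (malpha m c)))"
      by (simp add: dual_arr_comp[OF ma na]
          ab_comp_assoc[OF ab_comp_hom[OF ab_comp_hom[OF ma na] l] na' ma'])
    finally show "lam S c = ab_comp (dual_arr (malpha (aqcs_comp S n m) c))
        (ab_comp (lam U (ob (mfun (aqcs_comp S n m)) c)) (malpha (aqcs_comp S n m) c))"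
      using c by (simp add: aqcs_comp_def comp_func_def compose_eq)
  qed
qed

lemma comp_func_id:
  assumes F: "is_functor C D F"
  shows "comp_func C (id_func D) F = F" "comp_func C F (id_func C) = F"
proof -
  have "ar F f \<in> Arr D" if "f \<in> Arr C" for f using F that by (auto simp: is_functor_def Hom_def)
  then show "comp_func C (id_func D) F = F" "comp_func C F (id_func C) = F"
    using F by (auto intro!: func.equality
        simp: is_functor_def comp_func_def id_func_def compose_def restrict_def extensional_def)
qed

lemma comp_func_assoc:
  assumes F: "is_functor C D F"
  shows "comp_func C H (comp_func C G F) = comp_func C (comp_func D H G) F"
proof -
  have "ar F f \<in> Arr D" if "f \<in> Arr C" for f using F that by (auto simp: is_functor_def Hom_def)
  then show ?thesis
    using F by (auto intro!: func.equality
        simp: is_functor_def comp_func_def compose_def restrict_def)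
qed

lemma category_AQCS: "category (AQCS :: (('v, 'x, 'a) aqcs,
  ('v, 'x, 'a) aqcs \<times> ('v, 'x, 'a) aqcs_mor \<times> ('v, 'x, 'a) aqcs) cat)"
proof (rule category.intro)
  fix f :: "('v, 'x, 'a) aqcs \<times> ('v, 'x, 'a) aqcs_mor \<times> ('v, 'x, 'a) aqcs"
  assume "f \<in> Arr AQCS"
  then obtain E E' S T m where f: "f = (S, m, T)" and S: "aqcs_over E S" and T: "aqcs_over E' T"
    and m: "m \<in> aqcs_hom S T" by (auto simp: AQCS_def)
  note M = aqcs_homD[OF S T m]
  have ext: "mchi m \<in> extensional (Obj (Ecat S))" "malpha m \<in> extensional (Obj (Ecat S))"
    using nat_transD(3)[OF M(2)] nat_transD(3)[OF M(3)] by auto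
  have "aqcs_comp S (aqcs_id T) m = m"
  proof (rule aqcs_mor.equality)
    show "mfun (aqcs_comp S (aqcs_id T) m) = mfun m"
      by (simp add: aqcs_comp_def aqcs_id_def comp_func_id[OF M(1)])
    show "mchi (aqcs_comp S (aqcs_id T) m) = mchi m"
      using ext(1) by (auto simp: aqcs_comp_def aqcs_id_def ab_comp_id_left[OF M(5)] M(4)
          restrict_def extensional_def)
    show "malpha (aqcs_comp S (aqcs_id T) m) = malpha m"
      using ext(2) by (auto simp: aqcs_comp_def aqcs_id_def ab_comp_id_left[OF M(6)] M(4)
          restrict_def extensional_def)
  qed simp
  then show "Comp AQCS (Id AQCS (Cod AQCS f)) f = f" by (simp add: f AQCS_def)
  have "aqcs_comp S m (aqcs_id S) = m"
  proof (rule aqcs_mor.equality)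
    show "mfun (aqcs_comp S m (aqcs_id S)) = mfun m"
      by (simp add: aqcs_comp_def aqcs_id_def comp_func_id[OF M(1)])
    show "mchi (aqcs_comp S m (aqcs_id S)) = mchi m"
      using ext(1) by (auto simp: aqcs_comp_def aqcs_id_def ab_comp_id_right[OF M(5)]
          restrict_def extensional_def id_func_def)
    show "malpha (aqcs_comp S m (aqcs_id S)) = malpha m"
      using ext(2) by (auto simp: aqcs_comp_def aqcs_id_def ab_comp_id_right[OF M(6)]
          restrict_def extensional_def id_func_def)
  qed simp
  then show "Comp AQCS f (Id AQCS (Dom AQCS f)) = f" by (simp add: f AQCS_def)
next
  fix f g h :: "('v, 'x, 'a) aqcs \<times> ('v, 'x, 'a) aqcs_mor \<times> ('v, 'x, 'a) aqcs"
  assume "f \<in> Arr AQCS" "g \<in> Arr AQCS" "h \<in> Arr AQCS"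
    "Dom AQCS g = Cod AQCS f" "Dom AQCS h = Cod AQCS g"
  then obtain E1 E2 E3 E4 S T U V k m n where
    fgh: "f = (S, k, T)" "g = (T, m, U)" "h = (U, n, V)"
    and S: "aqcs_over E1 S" and T: "aqcs_over E2 T" and U: "aqcs_over E3 U" and V: "aqcs_over E4 V"
    and k: "k \<in> aqcs_hom S T" and m: "m \<in> aqcs_hom T U" and n: "n \<in> aqcs_hom U V"
    by (auto simp: AQCS_def)
  note K = aqcs_homD[OF S T k] and M = aqcs_homD[OF T U m] and N = aqcs_homD[OF U V n]
  have "aqcs_comp S n (aqcs_comp S m k) = aqcs_comp S (aqcs_comp T n m) k"
    using comp_func_assoc[OF K(1)] K(4)
    by (auto intro!: aqcs_mor.equality restrict_ext
        ab_comp_assoc[OF K(5) M(5)[OF K(4)] N(5)[OF M(4)[OF K(4)]]]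
        ab_comp_assoc[OF K(6) M(6)[OF K(4)] N(6)[OF M(4)[OF K(4)]]]
        simp: aqcs_comp_def comp_func_def compose_eq)
  then show "Comp AQCS h (Comp AQCS g f) = Comp AQCS (Comp AQCS h g) f"
    by (simp add: fgh AQCS_def)
qed (auto simp: AQCS_def Hom_def intro: aqcs_id_hom aqcs_comp_hom)

end

theory Submission
  imports Defs
begin

text \<open>The base of the empty structure has neither objects nor arrows, so every law asked of a
  structure on it, or of a morphism out of it, is vacuous. What remains is extensionality, which
  leaves one candidate for each component, the constant \<open>undefined\<close>. Hence
  \<open>empty_aqcs\<close> is an object (\<open>aqcs_over_empty\<close>) and has exactly one
  morphism to any target (\<open>aqcs_hom_empty\<close>).\<close>

text \<open>A walk must start at a vertex, so even trivial paths are missing, and the quotient of no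
  arrows has no classes.\<close>

lemma signed_path_cat_empty_digraph [simp]:
  "Obj (signed_path_cat empty_digraph) = {}" "Arr (signed_path_cat empty_digraph) = {}"
  by (auto simp: signed_path_cat_def quotient_cat_def path_cat_def signed_digraph_def
      empty_digraph_def pre_digraph.awalk_def quotient_def)

lemma is_functor_empty_iff:
  assumes "Obj C = {}" "Arr C = {}"
  shows "is_functor C D F \<longleftrightarrow> F = empty_func"
  using assms by (auto simp: is_functor_def empty_func_def intro: func.equality)

lemma nat_trans_empty_iff:
  assumes "Obj C = {}" "Arr C = {}"
  shows "nat_trans C D F G \<eta> \<longleftrightarrow> \<eta> = (\<lambda>_. undefined)"
  using assms by (auto simp: nat_trans_def)

lemma comp_func_empty:
  assumes "Obj C = {}" "Arr C = {}"
  shows "comp_func C G F = empty_func"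
  using assms by (simp add: comp_func_def compose_def empty_func_def restrict_def)

text \<open>The Set-valued functor required is \<open>empty_func\<close> itself, at another
  type.\<close>

lemma free_abelian_sheaf_empty:
  assumes "Obj C = {}" "Arr C = {}"
  shows "free_abelian_sheaf C empty_func"
  by (simp add: assms free_abelian_sheaf_def is_functor_empty_iff comp_func_empty)

lemma aqcs_over_empty: "aqcs_over empty_digraph empty_aqcs"
proof -
  have "pair_loopfree_digraph empty_digraph"
    by unfold_locales (auto simp: empty_digraph_def)
  \<comment> \<open>The opposite base is empty too, which settles \<open>Xsh\<close>; the section
    \<rho> can only be the constant \<open>undefined\<close> family.\<close>
  then show ?thesis
    by (auto simp: aqcs_over_def acs_over_def empty_aqcs_def free_abelian_sheaf_empty
        factorization_contra_co_def factorization_co_contra_def pairing_def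
        right_nondegenerate_def)
qed

text \<open>The data of \<open>S\<close> enter only at objects and arrows of the empty base; a
  singleton gives existence and uniqueness together.\<close>

lemma aqcs_hom_empty:
  "aqcs_hom empty_aqcs S = {\<lparr>mfun = empty_func, mchi = (\<lambda>_. undefined), malpha = (\<lambda>_. undefined)\<rparr>}"
  by (auto simp: aqcs_hom_def empty_aqcs_def is_functor_empty_iff nat_trans_empty_iff)

theorem proposition3p9:
  shows "initial (AQCS :: (('v, 'x, 'a) aqcs,
    ('v, 'x, 'a) aqcs \<times> ('v, 'x, 'a) aqcs_mor \<times> ('v, 'x, 'a) aqcs) cat) empty_aqcs"
  \<comment> \<open>Arrows of \<open>AQCS\<close> carry their domain and codomain, so the single
    morphism tuple determines the whole triple.\<close>
  using aqcs_over_empty by (auto simp: initial_def Hom_def AQCS_def aqcs_hom_empty)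

end
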